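(* Let $\ell_1\ge1$ and $1\le \ell_2\le k_2$ be integers, let $p\in[0,1]$, $q=1-p$, and put $a(p)=q^{\ell_1}p^{\ell_2}$, $\ell=\ell_1+\ell_2$, $m_2=k_2-\ell_2+1$. Let $H^n_{\ell_1,\ell_2,k_2}$ be the number of occurrences, in $n$ independent Bernoulli($p$) trials, of at least $\ell_1$ consecutive 0's followed by at least $\ell_2$ and at most $k_2$ consecutive 1's. Define, for integers $n\ge0$ and $m\ge 0$, $$\chi_n(t)=\sum_{u=0}^{\lfloor n/\ell\rfloor}\ \sum_{v=0}^{\lfloor (n-u\ell)/(\ell+m_2)\rfloor}\binom{n-u(\ell-1)-v(\ell+m_2-1)}{n-u\ell-v(\ell+m_2),\,u,\,v}(-1)^v p^{v m_2}(a(p)(t-1))^{u+v},$$ $$\mathcal V_{m,n}=\sum_{u=0}^{\lfloor n/\ell\rfloor}\ \sum_{v=0}^{\lfloor (n-u\ell)/(\ell+m_2)\rfloor}\binom{n-u(\ell-1)-v(\ell+m_2-1)}{n-u\ell-v(\ell+m_2),\,u,\,v}\binom{u+v}{m}(-1)^{u-m}p^{v m_2}a(p)^{u+v},$$ and $\chi_n(t)=0$ for $n<0$, $\mathcal V_{m,n}=0$ if $n<0$ or $m<0$. Then, for $n\ge \ell+1$, the probability generating function $\phi_n(t)$ and the probability mass function $p_{m,n}$ ($m\ge0$) of $H^n_{\ell_1,\ell_2,k_2}$ are given by (i) $\displaystyle \phi_n(t)=\chi_n(t)-a(p)(t-1)\sum_{i=\ell}^{\ell+m_2-1}p^{i-\ell}\chi_{n-i}(t)$;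 (ii) $\displaystyle p_{m,n}=\mathcal V_{m,n}-a(p)\sum_{i=\ell}^{\ell+m_2-1}p^{i-\ell}\left(\mathcal V_{m-1,n-i}-\mathcal V_{m,n-i}\right)$.
   Context: Let $\zeta_1,\zeta_2,\dots$ be independent with $P(\zeta_i=1)=p$ and $P(\zeta_i=0)=q=1-p$. $H^n_{\ell_1,\ell_2,k_2}$ is the number of occurrences of the following pattern within $\zeta_1,\dots,\zeta_n$: at least $\ell_1$ consecutive 0's, immediately followed by exactly $i$ consecutive 1's for some $\ell_2\le i\le k_2$, immediately followed by a 0, where this terminating 0 is at a position $\le n$. (The pattern is counted only when the terminating 0 occurs, so a final block of 1's not yet ended by a 0 within the first $n$ trials is not counted.) Equivalently, $H^n_{\ell_1,\ell_2,k_2}$ is the number of positions $m\ge1$ for which there is $t\in\{0,\dots,k_2-\ell_2\}$ with $m+t+\ell_1+\ell_2\le n$, $\zeta_m=\dots=\zeta_{m+\ell_1-1}=0$, $\zeta_{m+\ell_1}=\dots=\zeta_{m+\ell_1+\ell_2+t-1}=1$ and $\zeta_{m+\ell_1+\ell_2+t}=0$. For example, for the sequence 00111101100010100011 of length 20, $H^{20}_{1,1,2}=3$, $H^{20}_{3,1,2}=1$, $H^{20}_{2,2,2}=0$, $H^{20}_{1,4,4}=1$. $\phi_n(t)=E\big[t^{H^n_{\ell_1,\ell_2,k_2}}\big]$ and $p_{m,n}=P(H^n_{\ell_1,\ell_2,k_2}=m)$. The multinomial coefficient is $\binom{N}{u_1,\dots,u_s}=\frac{N!}{u_1!\cdots u_s!}$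 and $\binom{u+v}{m}=0$ if $m>u+v$. Convention $0^0=1$. *)

theory Defs
  imports "HOL-Probability.Probability"
begin

text \<open>
  The trials are indexed from 1: the outcome of trial \<open>i \<ge> 1\<close> is \<open>x i\<close>.

  An occurrence is identified by the position \<open>m\<close> where the last \<open>l1\<close> zeros begin in front of a block of
  exactly \<open>l2 + t\<close> ones, so a run of more than \<open>l1\<close> zeros gives a single occurrence; the zero
  that terminates the block of ones has to be among the first \<open>n\<close> trials.
\<close>

definition pattern_at :: "nat \<Rightarrow> nat \<Rightarrow> nat \<Rightarrow> nat \<Rightarrow> (nat \<Rightarrow> nat) \<Rightarrow> nat \<Rightarrow> bool" where
  "pattern_at l1 l2 k2 n x m \<longleftrightarrow>
     (\<exists>t \<le> k2 - l2. m + t + l1 + l2 \<le> n \<and>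
        (\<forall>i \<in> {m..<m + l1}. x i = 0) \<and>
        (\<forall>i \<in> {m + l1..<m + l1 + l2 + t}. x i = 1) \<and>
        x (m + l1 + l2 + t) = 0)"

definition pattern_count :: "nat \<Rightarrow> nat \<Rightarrow> nat \<Rightarrow> nat \<Rightarrow> (nat \<Rightarrow> nat) \<Rightarrow> nat" where
  "pattern_count l1 l2 k2 n x = card {m. 1 \<le> m \<and> pattern_at l1 l2 k2 n x m}"

definition multinomial :: "nat \<Rightarrow> nat list \<Rightarrow> real" where
  "multinomial N us = fact N / (\<Prod>u\<leftarrow>us. fact u)"

definition a_coeff :: "nat \<Rightarrow> nat \<Rightarrow> real \<Rightarrow> real" where
  "a_coeff l1 l2 p = (1 - p) ^ l1 * p ^ l2"

text \<open>
  The indices \<open>n\<close> and \<open>m\<close> of \<open>\<chi>\<close> and \<open>\<V>\<close> are integers, since both functions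
  are also evaluated (with value 0) at negative indices. All subtractions on \<open>nat\<close> below are
  exact within the ranges of summation.
\<close>

definition chi :: "nat \<Rightarrow> nat \<Rightarrow> nat \<Rightarrow> real \<Rightarrow> int \<Rightarrow> real \<Rightarrow> real" where
  "chi l1 l2 k2 p n t =
     (if n < 0 then 0 else
      let N = nat n; l = l1 + l2; m2 = k2 - l2 + 1 in
      \<Sum>u = 0..N div l. \<Sum>v = 0..(N - u * l) div (l + m2).
        multinomial (N - u * (l - 1) - v * (l + m2 - 1)) [N - u * l - v * (l + m2), u, v]
        * (-1) ^ v * p ^ (v * m2) * (a_coeff l1 l2 p * (t - 1)) ^ (u + v))"

definition VV :: "nat \<Rightarrow> nat \<Rightarrow> nat \<Rightarrow> real \<Rightarrow> int \<Rightarrow> int \<Rightarrow> real" where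
  "VV l1 l2 k2 p m n =
     (if n < 0 \<or> m < 0 then 0 else
      let N = nat n; l = l1 + l2; m2 = k2 - l2 + 1 in
      \<Sum>u = 0..N div l. \<Sum>v = 0..(N - u * l) div (l + m2).
        multinomial (N - u * (l - 1) - v * (l + m2 - 1)) [N - u * l - v * (l + m2), u, v]
        * real ((u + v) choose nat m) * (-1) powi (int u - m) * p ^ (v * m2)
        * a_coeff l1 l2 p ^ (u + v))"

end

theory Submission
  imports Defs "HOL-Library.Sublist"
begin

text \<open>
  Put \<open>s = t - 1\<close>. Dropping the first trial removes an occurrence exactly when the sequence starts with
  \<open>0\<^sup>l\<^sup>1 1\<^sup>i 0\<close> for some \<open>l2 \<le> i \<le> k2\<close>, and in that case no other occurrence starts before the final
  \<open>0\<close>, which is free to begin the next one. As a sequence starting with 1 has as many occurrences as its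
  tail, the contribution of sequences of length \<open>k\<close> starting with 0 is \<open>\<phi>\<^sub>k - p \<phi>\<^sub>k\<^sub>-\<^sub>1\<close>; the sum over \<open>i\<close> then
  telescopes to
  \<open>\<phi>\<^sub>n = \<phi>\<^sub>n\<^sub>-\<^sub>1 + s a \<phi>\<^sub>n\<^sub>-\<^sub>l - s a p\<^sup>m\<^sup>2 \<phi>\<^sub>n\<^sub>-\<^sub>l\<^sub>-\<^sub>m\<^sub>2\<close>,
  up to an inhomogeneous term coming from \<open>\<phi>\<^sub>0\<close>. By Pascal's rule for trinomial coefficients \<open>\<chi>\<close> is the
  fundamental solution of the same recurrence, which gives (i); (ii) follows by comparing
  coefficients of powers of \<open>t\<close>.
\<close>

section \<open>Counting occurrences in a list\<close>

definition has_pattern_prefix :: "nat \<Rightarrow> nat \<Rightarrow> nat \<Rightarrow> nat list \<Rightarrow> bool" where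
  "has_pattern_prefix l1 l2 k2 xs \<longleftrightarrow>
     (\<exists>i\<in>{l2..k2}. prefix (replicate l1 0 @ replicate i 1 @ [0]) xs)"

text \<open>Recursion on suffixes: removing the first trial, on which the recurrence for the
  generating function rests, becomes the defining equation.\<close>

primrec list_count :: "nat \<Rightarrow> nat \<Rightarrow> nat \<Rightarrow> nat list \<Rightarrow> nat" where
  "list_count l1 l2 k2 [] = 0"
| "list_count l1 l2 k2 (x # xs) =
     of_bool (has_pattern_prefix l1 l2 k2 (x # xs)) + list_count l1 l2 k2 xs"

section \<open>Positions of occurrences as suffixes of the word of outcomes\<close>

lemma prefix_map_upt_iff:
  "prefix u (map x [m..<m + n]) \<longleftrightarrow> length u \<le> n \<and> (\<forall>i<length u. x (m + i) = u ! i)"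
proof -
  have "prefix u ys \<longleftrightarrow> length u \<le> length ys \<and> (\<forall>i<length u. ys ! i = u ! i)" for ys
  proof
    assume "prefix u ys"
    then show "length u \<le> length ys \<and> (\<forall>i<length u. ys ! i = u ! i)"
      by (auto simp: prefix_def nth_append)
  next
    assume "length u \<le> length ys \<and> (\<forall>i<length u. ys ! i = u ! i)"
    then have "take (length u) ys = u"
      by (intro nth_equalityI) auto
    then show "prefix u ys"
      by (metis take_is_prefix)
  qed
  then show ?thesis
    by (auto simp: nth_append)
qed

text \<open>The block of ones has length \<open>i = l2 + t\<close>. That the prefix fits into the
  suffix starting at \<open>m\<close> says exactly that the terminating zero lies at a position at
  most \<open>n\<close>.\<close>

lemma pattern_at_iff_prefix:
  assumes "l2 \<le> k2" "m \<le> n"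
  shows "pattern_at l1 l2 k2 n x m \<longleftrightarrow> has_pattern_prefix l1 l2 k2 (map x [m..<Suc n])"
proof -
  have eq: "Suc n = m + (Suc n - m)"
    using assms by simp
  have block: "prefix (replicate l1 0 @ replicate i 1 @ [0]) (map x [m..<Suc n]) \<longleftrightarrow>
      m + l1 + i \<le> n \<and> (\<forall>j\<in>{m..<m + l1}. x j = 0) \<and>
      (\<forall>j\<in>{m + l1..<m + l1 + i}. x j = 1) \<and> x (m + l1 + i) = 0" for i
  proof -
    have "(\<forall>j<l1 + i + 1. x (m + j) = (replicate l1 0 @ replicate i 1 @ [0]) ! j) \<longleftrightarrow>
        (\<forall>j\<in>{m..<m + l1}. x j = 0) \<and>
        (\<forall>j\<in>{m + l1..<m + l1 + i}. x j = 1) \<and> x (m + l1 + i) = 0" (is "?L \<longleftrightarrow> ?R")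
    proof
      assume L: ?L
      have "x j = 0" if "j \<in> {m..<m + l1}" for j
        using L[rule_format, of "j - m"] that by (auto simp: nth_append)
      moreover have "x j = 1" if "j \<in> {m + l1..<m + l1 + i}" for j
        using L[rule_format, of "j - m"] that by (auto simp: nth_append)
      moreover have "x (m + l1 + i) = 0"
        using L[rule_format, of "l1 + i"] by (auto simp: nth_append add.assoc)
      ultimately show ?R by blast
    next
      assume R: ?R
      show ?L
      proof (intro allI impI)
        fix j assume "j < l1 + i + 1"
        then consider "j < l1" | "l1 \<le> j" "j < l1 + i" | "j = l1 + i" by linarith
        then show "x (m + j) = (replicate l1 0 @ replicate i 1 @ [0]) ! j"
          using R by cases (auto simp: nth_append add.assoc)
      qed
    qed
    then show ?thesis
      by (subst eq, subst prefix_map_upt_iff) (use assms in auto)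
  qed
  show ?thesis
    unfolding has_pattern_prefix_def block pattern_at_def
  proof
    assume "\<exists>t\<le>k2 - l2. m + t + l1 + l2 \<le> n \<and> (\<forall>i\<in>{m..<m + l1}. x i = 0) \<and>
      (\<forall>i\<in>{m + l1..<m + l1 + l2 + t}. x i = 1) \<and> x (m + l1 + l2 + t) = 0"
    then obtain t where "t \<le> k2 - l2" "m + t + l1 + l2 \<le> n" "\<forall>i\<in>{m..<m + l1}. x i = 0"
      "\<forall>i\<in>{m + l1..<m + l1 + l2 + t}. x i = 1" "x (m + l1 + l2 + t) = 0" by blast
    then show "\<exists>i\<in>{l2..k2}. m + l1 + i \<le> n \<and> (\<forall>j\<in>{m..<m + l1}. x j = 0) \<and>
      (\<forall>j\<in>{m + l1..<m + l1 + i}. x j = 1) \<and> x (m + l1 + i) = 0"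
      using assms by (intro bexI[of _ "l2 + t"]) (auto simp: add.assoc)
  next
    assume "\<exists>i\<in>{l2..k2}. m + l1 + i \<le> n \<and> (\<forall>j\<in>{m..<m + l1}. x j = 0) \<and>
      (\<forall>j\<in>{m + l1..<m + l1 + i}. x j = 1) \<and> x (m + l1 + i) = 0"
    then obtain i where "i \<in> {l2..k2}" "m + l1 + i \<le> n" "\<forall>j\<in>{m..<m + l1}. x j = 0"
      "\<forall>j\<in>{m + l1..<m + l1 + i}. x j = 1" "x (m + l1 + i) = 0" by blast
    then show "\<exists>t\<le>k2 - l2. m + t + l1 + l2 \<le> n \<and> (\<forall>i\<in>{m..<m + l1}. x i = 0) \<and>
      (\<forall>i\<in>{m + l1..<m + l1 + l2 + t}. x i = 1) \<and> x (m + l1 + l2 + t) = 0"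
      by (intro exI[of _ "i - l2"]) (auto simp: add.assoc)
  qed
qed

lemma pattern_at_le: "pattern_at l1 l2 k2 n x m \<Longrightarrow> m \<le> n"
  by (auto simp: pattern_at_def)

lemma pattern_count_eq_list_count:
  assumes "l2 \<le> k2"
  shows "pattern_count l1 l2 k2 n x = list_count l1 l2 k2 (map x [1..<Suc n])"
proof -
  define A where "A k = {m. k \<le> m \<and> pattern_at l1 l2 k2 n x m}" for k
  have fin: "finite (A k)" for k
    by (rule finite_subset[of _ "{..n}"]) (auto simp: A_def dest: pattern_at_le)
  \<comment> \<open>Downward induction on the start \<open>k\<close>: passing from
    \<open>Suc k\<close> to \<open>k\<close> prepends one letter and adds at most the occurrence at
    \<open>k\<close> itself.\<close>
  have "card (A k) = list_count l1 l2 k2 (map x [k..<Suc n])" if "k \<le> Suc n" for k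
    using that
  proof (induction k rule: inc_induct)
    case base
    have "A (Suc n) = {}"
      by (auto simp: A_def dest: pattern_at_le)
    then show ?case by simp
  next
    case (step k)
    have "A k = (if pattern_at l1 l2 k2 n x k then insert k (A (Suc k)) else A (Suc k))"
      by (auto simp: A_def le_Suc_eq Suc_le_eq order.order_iff_strict)
    moreover have "k \<notin> A (Suc k)"
      by (simp add: A_def)
    ultimately have "card (A k) = of_bool (pattern_at l1 l2 k2 n x k) + card (A (Suc k))"
      using fin[of "Suc k"] by auto
    then show ?case
      using step pattern_at_iff_prefix[OF assms, of k n l1 x] by (simp add: upt_conv_Cons del: upt_Suc)
  qed
  from this[of 1] show ?thesis
    by (simp add: A_def pattern_count_def)
qed

lemma list_count_le_length: "list_count l1 l2 k2 xs \<le> length xs"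
  by (induction xs) auto

section \<open>Counting after the removal of a leading block\<close>

lemma list_count_Cons_1:
  assumes "1 \<le> l1"
  shows "list_count l1 l2 k2 (1 # xs) = list_count l1 l2 k2 xs"
  using assms by (cases l1) (auto simp: has_pattern_prefix_def)

text \<open>The letter with index \<open>j\<close> is a 1, whereas an occurrence at the start would
  force it to be one of \<open>l1\<close> zeros.\<close>

lemma not_pattern_prefix_zeros_ones:
  assumes "1 \<le> i" "j < l1"
  shows "\<not> has_pattern_prefix l1 l2 k2 (replicate j 0 @ replicate i 1 @ xs)"
proof
  assume "has_pattern_prefix l1 l2 k2 (replicate j 0 @ replicate i 1 @ xs)"
  then obtain ys where eq: "replicate j 0 @ replicate i 1 @ xs = replicate l1 0 @ ys"
    by (auto simp: has_pattern_prefix_def prefix_def)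
  have "(replicate j 0 @ replicate i 1 @ xs) ! j = 1"
    using assms by (simp add: nth_append)
  moreover have "(replicate l1 0 @ ys) ! j = 0"
    using assms by (simp add: nth_append)
  ultimately show False
    unfolding eq by simp
qed

text \<open>Any later start inside the block sees fewer than \<open>l1\<close> zeros before a 1, or
  a 1 at once, so no occurrence begins there. In the application \<open>xs\<close> starts with the
  terminating zero, which may open the next occurrence.\<close>

lemma list_count_pattern_tail:
  assumes "1 \<le> l1" "1 \<le> i"
  shows "list_count l1 l2 k2 (tl (replicate l1 0 @ replicate i 1 @ xs)) = list_count l1 l2 k2 xs"
proof -
  have ones: "list_count l1 l2 k2 (replicate j 1 @ xs) = list_count l1 l2 k2 xs" for j
    using list_count_Cons_1[OF assms(1)] by (induction j) (auto simp del: list_count.simps One_nat_def)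
  have "list_count l1 l2 k2 (replicate j 0 @ replicate i 1 @ xs) = list_count l1 l2 k2 xs" 
    if "j < l1" for j
    using that
  proof (induction j)
    case (Suc j)
    then show ?case
      using not_pattern_prefix_zeros_ones[OF assms(2) Suc.prems] by auto
  qed (simp add: ones del: One_nat_def)
  from this[of "l1 - 1"] show ?thesis
    using assms by (cases l1) auto
qed

section \<open>Bernoulli weights on binary words\<close>

text \<open>The expectation of \<open>f\<close> over \<open>n\<close> independent Bernoulli letters,
  computed by conditioning on the first one. As a finite sum it is linear without any integrability
  condition.\<close>

primrec bern_sum :: "real \<Rightarrow> nat \<Rightarrow> (nat list \<Rightarrow> real) \<Rightarrow> real" where
  "bern_sum p 0 f = f []"
| "bern_sum p (Suc n) f =
     (1 - p) * bern_sum p n (\<lambda>xs. f (0 # xs)) + p * bern_sum p n (\<lambda>xs. f (1 # xs))"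

lemma bern_sum_add: "bern_sum p n (\<lambda>xs. f xs + g xs) = bern_sum p n f + bern_sum p n g"
  by (induction n arbitrary: f g) (auto simp: algebra_simps)

lemma bern_sum_cmult: "bern_sum p n (\<lambda>xs. c * f xs) = c * bern_sum p n f"
  by (induction n arbitrary: f) (auto simp: algebra_simps)

lemma bern_sum_zero [simp]: "bern_sum p n (\<lambda>xs. 0) = 0"
  by (induction n) auto

lemma bern_sum_sum: "bern_sum p n (\<lambda>xs. \<Sum>i\<in>I. f i xs) = (\<Sum>i\<in>I. bern_sum p n (f i))"
  by (induction I rule: infinite_finite_induct) (auto simp: bern_sum_add)

lemma bern_sum_cong:
  "(\<And>xs. length xs = n \<Longrightarrow> f xs = g xs) \<Longrightarrow> bern_sum p n f = bern_sum p n g"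
proof (induction n arbitrary: f g)
  case (Suc n)
  show ?case
    using Suc.IH[of "\<lambda>xs. f (0 # xs)" "\<lambda>xs. g (0 # xs)"]
      Suc.IH[of "\<lambda>xs. f (1 # xs)" "\<lambda>xs. g (1 # xs)"] Suc.prems by simp
qed simp

definition word_weight :: "real \<Rightarrow> nat list \<Rightarrow> real" where
  "word_weight p xs = (\<Prod>x\<leftarrow>xs. if x = 0 then 1 - p else p)"

text \<open>Independence: each letter of \<open>u\<close> selects one branch of
  \<open>bern_sum\<close> and kills the other, and the letters after \<open>u\<close> stay
  free.\<close>

lemma bern_sum_prefix:
  assumes "set u \<subseteq> {0, 1}" "length u \<le> n"
  shows "bern_sum p n (\<lambda>xs. of_bool (prefix u xs) * f xs) =
    word_weight p u * bern_sum p (n - length u) (\<lambda>xs. f (u @ xs))"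
  using assms
proof (induction u arbitrary: n f)
  case Nil
  then show ?case by (simp add: word_weight_def)
next
  case (Cons x u)
  then obtain k where n: "n = Suc k" "length u \<le> k"
    by (cases n) auto
  have "x = 0 \<or> x = 1"
    using Cons.prems by auto
  then show ?case
    using Cons.IH[of k "\<lambda>xs. f (x # xs)"] Cons.prems n by (auto simp: word_weight_def)
qed

lemma bern_sum_eq_sum_lists:
  "bern_sum p n f = (\<Sum>xs | length xs = n \<and> set xs \<subseteq> {0, 1}. word_weight p xs * f xs)"
proof (induction n arbitrary: f)
  case 0
  have "{xs::nat list. length xs = 0 \<and> set xs \<subseteq> {0, 1}} = {[]}" by auto
  then show ?case by (simp add: word_weight_def)
next
  case (Suc n)
  let ?L = "{xs::nat list. length xs = n \<and> set xs \<subseteq> {0, 1}}"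
  have fin: "finite ?L"
    using finite_lists_length_eq[of "{0, 1::nat}" n] by (simp add: conj_commute)
  have split: "{xs::nat list. length xs = Suc n \<and> set xs \<subseteq> {0, 1}} = (#) 0 ` ?L \<union> (#) 1 ` ?L"
    by (auto simp: length_Suc_conv image_iff)
  have "(\<Sum>xs | length xs = Suc n \<and> set xs \<subseteq> {0, 1}. word_weight p xs * f xs) =
     (\<Sum>xs\<in>(#) 0 ` ?L. word_weight p xs * f xs) + (\<Sum>xs\<in>(#) 1 ` ?L. word_weight p xs * f xs)"
    unfolding split by (intro sum.union_disjoint) (use fin in auto)
  also have "\<dots> = bern_sum p (Suc n) f"
    by (simp add: Suc.IH sum.reindex word_weight_def sum_distrib_left mult.assoc)
  finally show ?case ..
qed

section \<open>Trinomial sums\<close>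

text \<open>The triples count parts of sizes 1, \<open>l\<close> and \<open>k\<close> in a
  composition of \<open>N\<close>. With \<open>N\<close> an integer, index shifts are uniform and a
  negative \<open>N\<close> gives the empty set.\<close>

definition solutions :: "nat \<Rightarrow> nat \<Rightarrow> int \<Rightarrow> (nat \<times> nat \<times> nat) set" where
  "solutions l k N = {(w, u, v). int (w + u * l + v * k) = N}"

definition trinomial :: "nat \<times> nat \<times> nat \<Rightarrow> real" where
  "trinomial = (\<lambda>(w, u, v). multinomial (w + u + v) [w, u, v])"

text \<open>For \<open>l\<close> and \<open>k\<close> at least 1 this is the coefficient of
  \<open>z^N\<close> in the power series of \<open>1 / (1 - z - A z^l - B z^k)\<close>.\<close>

definition trinomial_sum :: "nat \<Rightarrow> nat \<Rightarrow> real \<Rightarrow> real \<Rightarrow> int \<Rightarrow> real" where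
  "trinomial_sum l k A B N = (\<Sum>x\<in>solutions l k N. trinomial x * A ^ fst (snd x) * B ^ snd (snd x))"

lemma solutions_int_iff: "(w, u, v) \<in> solutions l k (int n) \<longleftrightarrow> w + u * l + v * k = n"
  by (simp only: solutions_def mem_Collect_eq prod.case of_nat_eq_iff)

lemma finite_solutions:
  assumes "1 \<le> l" "1 \<le> k"
  shows "finite (solutions l k N)"
proof (rule finite_subset)
  show "solutions l k N \<subseteq> {..nat N} \<times> {..nat N} \<times> {..nat N}"
  proof (clarsimp simp: solutions_def)
    fix w u v
    have "u * 1 \<le> u * l" "v * 1 \<le> v * k"
      using assms by (simp_all only: mult_le_mono order.refl)
    then have "w \<le> w + u * l + v * k \<and> u \<le> w + u * l + v * k \<and> v \<le> w + u * l + v * k"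
      by linarith
    then show "w \<le> nat (int w + int u * int l + int v * int k) \<and>
       u \<le> nat (int w + int u * int l + int v * int k) \<and>
       v \<le> nat (int w + int u * int l + int v * int k)"
      by (simp flip: of_nat_mult of_nat_add)
  qed
qed auto

lemma trinomial_zero: "trinomial (0, 0, 0) = 1"
  by (simp add: trinomial_def multinomial_def)

text \<open>Lowering one entry of a multinomial coefficient multiplies it by that entry over the
  total; \<open>D\<close> stands for the factorials of the other entries.\<close>

lemma fact_ratio_step:
  "fact n / (fact k * D) = real (Suc k) / real (Suc n) * (fact (Suc n) / (fact (Suc k) * D))"
  by (simp add: divide_simps del: of_nat_Suc)

text \<open>The three terms on the right are the fractions \<open>w/N\<close>, \<open>u/N\<close>
  and \<open>v/N\<close> of the left side, where \<open>N = w + u + v\<close>, and these fractions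
  add up to 1.\<close>

lemma trinomial_Pascal:
  assumes "(w, u, v) \<noteq> (0, 0, 0)"
  shows "trinomial (w, u, v) =
    (if w = 0 then 0 else trinomial (w - 1, u, v)) +
    (if u = 0 then 0 else trinomial (w, u - 1, v)) +
    (if v = 0 then 0 else trinomial (w, u, v - 1))"
proof -
  define N where "N = w + u + v"
  have N: "N > 0"
    using assms by (auto simp: N_def)
  \<comment> \<open>Three orders of the denominator, each with the factorial to be lowered in front,
    as \<open>fact_ratio_step\<close> expects.\<close>
  have T: "trinomial (w, u, v) = fact (w + u + v) / (fact w * (fact u * fact v))"
    "trinomial (w, u, v) = fact (w + u + v) / (fact u * (fact w * fact v))"
    "trinomial (w, u, v) = fact (w + u + v) / (fact v * (fact w * fact u))" for w u v
    by (simp_all add: trinomial_def multinomial_def mult_ac)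
  have w: "(if w = 0 then 0 else trinomial (w - 1, u, v)) = real w / real N * trinomial (w, u, v)"
    unfolding T(1) N_def by (cases w) (use fact_ratio_step[of "w - 1 + u + v" "w - 1"] in simp_all)
  have u: "(if u = 0 then 0 else trinomial (w, u - 1, v)) = real u / real N * trinomial (w, u, v)"
    unfolding T(2) N_def by (cases u) (use fact_ratio_step[of "w + (u - 1) + v" "u - 1"] in simp_all)
  have v: "(if v = 0 then 0 else trinomial (w, u, v - 1)) = real v / real N * trinomial (w, u, v)"
    unfolding T(3) N_def by (cases v) (use fact_ratio_step[of "w + u + (v - 1)" "v - 1"] in simp_all)
  have "real w / real N + real u / real N + real v / real N = 1"
    using N by (simp add: N_def flip: add_divide_distrib of_nat_add)
  then show ?thesis
    unfolding w u v distrib_right[symmetric] by (simp only: mult_1)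
qed

text \<open>Meant for shifting one coordinate of a triple by \<open>Suc\<close>: the triples missed
  by the shift have that coordinate 0, and the summand vanishes there.\<close>

lemma sum_reindex_zero_outside:
  assumes "finite S" "inj_on g S'" "g ` S' \<subseteq> S"
    and "\<And>x. x \<in> S - g ` S' \<Longrightarrow> h x = 0" "\<And>x. x \<in> S' \<Longrightarrow> h (g x) = f x"
  shows "sum h S = sum f S'"
proof -
  have "sum h S = sum h (g ` S')"
    using assms by (intro sum.mono_neutral_right) auto
  also have "\<dots> = sum f S'"
    using assms by (simp add: sum.reindex)
  finally show ?thesis .
qed

text \<open>Pascal's rule is applied to every summand; lowering \<open>w\<close>, \<open>u\<close>
  or \<open>v\<close> by one lowers \<open>N\<close> by 1, \<open>l\<close> or
  \<open>k\<close>.\<close>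

lemma trinomial_sum_rec:
  assumes "1 \<le> l" "1 \<le> k"
  shows "trinomial_sum l k A B N = trinomial_sum l k A B (N - 1) +
    A * trinomial_sum l k A B (N - int l) + B * trinomial_sum l k A B (N - int k) + of_bool (N = 0)"
proof -
  define g where "g = (\<lambda>x. trinomial x * A ^ fst (snd x) * B ^ snd (snd x))"
  note fin = finite_solutions[OF assms]
  have S: "trinomial_sum l k A B N = sum g (solutions l k N)" for N
    by (simp add: trinomial_sum_def g_def)
  \<comment> \<open>Pascal's rule fails only at the zero triple, which occurs for
    \<open>N = 0\<close>; this is the source of the inhomogeneous term.\<close>
  have g: "g x = (\<lambda>(w, u, v). if w = 0 then 0 else g (w - 1, u, v)) x +
      (\<lambda>(w, u, v). if u = 0 then 0 else A * g (w, u - 1, v)) x +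
      (\<lambda>(w, u, v). if v = 0 then 0 else B * g (w, u, v - 1)) x + of_bool (x = (0, 0, 0))" for x
  proof (cases "x = (0, 0, 0)")
    case True
    then show ?thesis by (simp add: g_def trinomial_zero)
  next
    case False
    obtain w u v where x: "x = (w, u, v)" by (cases x)
    show ?thesis
      using trinomial_Pascal[of w u v] False unfolding x g_def
      by (cases "w = 0"; cases "u = 0"; cases "v = 0")
        (simp_all add: algebra_simps power_eq_if)
  qed
  have W: "(\<Sum>x\<in>solutions l k N. (\<lambda>(w, u, v). if w = 0 then 0 else g (w - 1, u, v)) x) =
      sum g (solutions l k (N - 1))"
    by (rule sum_reindex_zero_outside[OF fin, where g = "\<lambda>(w, u, v). (Suc w, u, v)"])
      (auto simp: inj_on_def solutions_def image_iff algebra_simps gr0_conv_Suc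
        split: prod.splits if_splits)
  have U: "(\<Sum>x\<in>solutions l k N. (\<lambda>(w, u, v). if u = 0 then 0 else A * g (w, u - 1, v)) x) =
      (\<Sum>x\<in>solutions l k (N - int l). A * g x)"
    by (rule sum_reindex_zero_outside[OF fin, where g = "\<lambda>(w, u, v). (w, Suc u, v)"])
      (auto simp: inj_on_def solutions_def image_iff algebra_simps gr0_conv_Suc
        split: prod.splits if_splits)
  have V: "(\<Sum>x\<in>solutions l k N. (\<lambda>(w, u, v). if v = 0 then 0 else B * g (w, u, v - 1)) x) =
      (\<Sum>x\<in>solutions l k (N - int k). B * g x)"
    by (rule sum_reindex_zero_outside[OF fin, where g = "\<lambda>(w, u, v). (w, u, Suc v)"])
      (auto simp: inj_on_def solutions_def image_iff algebra_simps gr0_conv_Suc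
        split: prod.splits if_splits)
  have Z: "(\<Sum>x\<in>solutions l k N. of_bool (x = (0, 0, 0))) = (of_bool (N = 0) :: real)"
  proof -
    have "(\<Sum>x\<in>solutions l k N. of_bool (x = (0, 0, 0)) :: real) =
        (\<Sum>x\<in>solutions l k N. if x = (0, 0, 0) then 1 else 0)"
      by (intro sum.cong) auto
    also have "\<dots> = of_bool (N = 0)"
      by (subst sum.delta[OF fin]) (auto simp: solutions_def)
    finally show ?thesis .
  qed
  have "trinomial_sum l k A B N = (\<Sum>x\<in>solutions l k N.
      (\<lambda>(w, u, v). if w = 0 then 0 else g (w - 1, u, v)) x +
      (\<lambda>(w, u, v). if u = 0 then 0 else A * g (w, u - 1, v)) x +
      (\<lambda>(w, u, v). if v = 0 then 0 else B * g (w, u, v - 1)) x + of_bool (x = (0, 0, 0)))"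
    unfolding S by (intro sum.cong refl g)
  also have "\<dots> = sum g (solutions l k (N - 1)) + (\<Sum>x\<in>solutions l k (N - int l). A * g x) +
      (\<Sum>x\<in>solutions l k (N - int k). B * g x) + of_bool (N = 0)"
    unfolding sum.distrib W U V Z ..
  also have "\<dots> = trinomial_sum l k A B (N - 1) + A * trinomial_sum l k A B (N - int l) +
      B * trinomial_sum l k A B (N - int k) + of_bool (N = 0)"
    by (simp only: S sum_distrib_left)
  finally show ?thesis .
qed

lemma trinomial_sum_neg: "N < 0 \<Longrightarrow> trinomial_sum l k A B N = 0"
  by (auto simp: trinomial_sum_def solutions_def simp del: of_nat_add of_nat_mult intro!: sum.neutral)

section \<open>Rewriting \<open>chi\<close> as a trinomial sum\<close>

lemma div_bounds_iff:
  assumes "1 \<le> l" "1 \<le> (k::nat)"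
  shows "u \<le> N div l \<and> v \<le> (N - u * l) div k \<longleftrightarrow> u * l + v * k \<le> N"
  using assms by (auto simp: less_eq_div_iff_mult_less_eq le_diff_conv2 add.commute)

text \<open>The nested bounds describe the pairs \<open>(u, v)\<close> that leave a nonnegative
  remainder \<open>w\<close>, so the double sum runs over \<open>solutions\<close>. The factor
  \<open>(-1)^v * p^(v * m2) * A^v\<close> is a \<open>v\<close>-th power and becomes the weight of
  the parts of size \<open>l + m2\<close>.\<close>

lemma chi_eq_trinomial_sum:
  fixes N :: int and p t :: real
  assumes "1 \<le> l1 + l2" and m2: "m2 = k2 - l2 + 1"
  defines "l \<equiv> l1 + l2" and "A \<equiv> a_coeff l1 l2 p * (t - 1)"
  shows "chi l1 l2 k2 p N t = trinomial_sum l (l + m2) A (- (p ^ m2 * A)) N"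
proof (cases "N < 0")
  case True
  then show ?thesis by (simp add: chi_def trinomial_sum_neg)
next
  case False
  define n where "n = nat N"
  have N: "N = int n"
    using False by (simp add: n_def)
  have l: "1 \<le> l"
    using assms by simp
  have bounds: "u \<le> n div l \<and> v \<le> (n - u * l) div (l + m2) \<longleftrightarrow> u * l + v * (l + m2) \<le> n" for u v
    using l by (intro div_bounds_iff) auto
  let ?h = "\<lambda>(u, v). (n - (u * l + v * (l + m2)), u, v)"
  have bij: "bij_betw ?h (SIGMA u:{0..n div l}. {0..(n - u * l) div (l + m2)}) (solutions l (l + m2) N)"
  proof (rule bij_betw_byWitness[where f' = snd])
    show "?h ` (SIGMA u:{0..n div l}. {0..(n - u * l) div (l + m2)}) \<subseteq> solutions l (l + m2) N"
    proof clarify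
      fix u v assume "u \<in> {0..n div l}" "v \<in> {0..(n - u * l) div (l + m2)}"
      then have "u * l + v * (l + m2) \<le> n"
        using bounds[of u v] by simp
      then show "(n - (u * l + v * (l + m2)), u, v) \<in> solutions l (l + m2) N"
        unfolding N solutions_int_iff by simp
    qed
    show "snd ` solutions l (l + m2) N \<subseteq> (SIGMA u:{0..n div l}. {0..(n - u * l) div (l + m2)})"
    proof (rule image_subsetI)
      fix x assume "x \<in> solutions l (l + m2) N"
      moreover obtain w u v where x: "x = (w, u, v)"
        by (cases x)
      ultimately have "u * l + v * (l + m2) \<le> n"
        unfolding N by (simp only: solutions_int_iff)
      then show "snd x \<in> (SIGMA u:{0..n div l}. {0..(n - u * l) div (l + m2)})"
        using bounds[of u v] by (simp add: x)
    qed
    show "\<forall>x\<in>solutions l (l + m2) N. ?h (snd x) = x"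
      unfolding N by (auto simp: solutions_int_iff)
  qed auto
  have "chi l1 l2 k2 p N t = (\<Sum>(u, v)\<in>(SIGMA u:{0..n div l}. {0..(n - u * l) div (l + m2)}).
      multinomial (n - u * (l - 1) - v * (l + m2 - 1)) [n - u * l - v * (l + m2), u, v]
        * (-1) ^ v * p ^ (v * m2) * A ^ (u + v))"
    using False unfolding chi_def Let_def m2[symmetric] l_def[symmetric] n_def[symmetric]
      A_def[symmetric] by (simp add: sum.Sigma)
  also have "\<dots> = (\<Sum>(u, v)\<in>(SIGMA u:{0..n div l}. {0..(n - u * l) div (l + m2)}).
      trinomial (?h (u, v)) * A ^ u * (- (p ^ m2 * A)) ^ v)"
  proof (rule sum.cong[OF refl], safe)
    fix u v assume "u \<in> {0..n div l}" "v \<in> {0..(n - u * l) div (l + m2)}"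
    then have le: "u * l + v * (l + m2) \<le> n"
      using bounds[of u v] by simp
    \<comment> \<open>These identities make the truncated subtractions exact, so the upper entry of
      the coefficient is \<open>w + u + v\<close>.\<close>
    have "u * (l - 1) + u = u * l" "v * (l + m2 - 1) + v = v * (l + m2)"
      using l by (cases l; simp)+
    with le have eq: "n - u * (l - 1) - v * (l + m2 - 1) = n - (u * l + v * (l + m2)) + u + v"
      by linarith
    have "(- (p ^ m2 * A)) ^ v = (-1) ^ v * p ^ (v * m2) * A ^ v"
      by (subst power_minus) (simp add: power_mult_distrib power_mult mult.commute[of v])
    then show "multinomial (n - u * (l - 1) - v * (l + m2 - 1)) [n - u * l - v * (l + m2), u, v]
        * (-1) ^ v * p ^ (v * m2) * A ^ (u + v) =
      trinomial (n - (u * l + v * (l + m2)), u, v) * A ^ u * (- (p ^ m2 * A)) ^ v"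
      unfolding eq by (simp add: trinomial_def power_add)
  qed
  also have "\<dots> = trinomial_sum l (l + m2) A (- (p ^ m2 * A)) N"
    unfolding trinomial_sum_def
    by (subst sum.reindex_bij_betw[OF bij, symmetric]) (auto intro!: sum.cong)
  finally show ?thesis .
qed

section \<open>Expansion of \<open>chi\<close> in powers of \<open>t\<close>\<close>

lemma binomial_expansion_shifted:
  fixes t :: real
  assumes "u + v \<le> M"
  shows "(-1) ^ v * (t - 1) ^ (u + v) =
    (\<Sum>m\<le>M. real ((u + v) choose m) * (-1) powi (int u - int m) * t ^ m)"
proof -
  have "(-1) ^ v * (t - 1) ^ (u + v) =
      (\<Sum>m\<le>u + v. real ((u + v) choose m) * ((-1) ^ v * (-1) ^ (u + v - m)) * t ^ m)"
    using binomial_ring[of t "-1" "u + v"] by (simp add: sum_distrib_left mult_ac)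
  \<comment> \<open>The two factors \<open>(-1)^v\<close> cancel, leaving the sign of
    \<open>u - m\<close>; this difference may be negative, hence the integer exponent.\<close>
  also have "\<dots> = (\<Sum>m\<le>u + v. real ((u + v) choose m) * (-1) powi (int u - int m) * t ^ m)"
  proof (intro sum.cong refl)
    fix m assume "m \<in> {..u + v}"
    then have "int (u + v - m) = int v + (int u - int m)"
      by simp
    then have "(-1) ^ (u + v - m) = (-1 :: real) powi (int v + (int u - int m))"
      by (metis power_int_of_nat)
    also have "\<dots> = (-1) ^ v * (-1) powi (int u - int m)"
      by (simp add: power_int_add)
    also have "(-1) ^ v * \<dots> = (-1) powi (int u - int m)"
      by (simp flip: mult.assoc power_mult_distrib)
    finally show "real ((u + v) choose m) * ((-1) ^ v * (-1) ^ (u + v - m)) * t ^ m =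
      real ((u + v) choose m) * (-1) powi (int u - int m) * t ^ m" by simp
  qed
  \<comment> \<open>The added binomial coefficients are 0; a common bound \<open>M\<close> allows
    the sum over \<open>m\<close> to be moved outside.\<close>
  also have "\<dots> = (\<Sum>m\<le>M. real ((u + v) choose m) * (-1) powi (int u - int m) * t ^ m)"
    using assms by (intro sum.mono_neutral_left) (auto simp: binomial_eq_0)
  finally show ?thesis .
qed

text \<open>\<open>VV\<close> lists the coefficients of the polynomial \<open>chi\<close> in
  \<open>t\<close>. Its degree is at most \<open>N\<close>, since \<open>l >= 1\<close> forces
  \<open>u + v <= N\<close> for every term.\<close>

lemma chi_eq_sum_VV:
  assumes "1 \<le> l1 + l2" "N \<le> int M"
  shows "chi l1 l2 k2 p N t = (\<Sum>m\<le>M. VV l1 l2 k2 p (int m) N * t ^ m)"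
proof (cases "N < 0")
  case True
  then show ?thesis by (simp add: chi_def VV_def)
next
  case False
  define n where "n = nat N"
  define l m2 A where "l = l1 + l2" and "m2 = k2 - l2 + 1" and "A = a_coeff l1 l2 p"
  define c where "c u v = multinomial (n - u * (l - 1) - v * (l + m2 - 1)) [n - u * l - v * (l + m2), u, v]"
    for u v
  have l: "1 \<le> l"
    using assms by (simp add: l_def)
  have "chi l1 l2 k2 p N t = (\<Sum>u = 0..n div l. \<Sum>v = 0..(n - u * l) div (l + m2).
      c u v * (-1) ^ v * p ^ (v * m2) * (A * (t - 1)) ^ (u + v))"
    using False unfolding chi_def Let_def m2_def[symmetric] l_def[symmetric] n_def[symmetric]
      A_def[symmetric] c_def by simp
  also have "\<dots> = (\<Sum>u = 0..n div l. \<Sum>v = 0..(n - u * l) div (l + m2). \<Sum>m\<le>M.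
      c u v * real ((u + v) choose m) * (-1) powi (int u - int m) * p ^ (v * m2) * A ^ (u + v) * t ^ m)"
  proof (intro sum.cong refl)
    fix u v assume "u \<in> {0..n div l}" "v \<in> {0..(n - u * l) div (l + m2)}"
    then have "u * l + v * (l + m2) \<le> n"
      using div_bounds_iff[OF l, of "l + m2"] l by auto
    moreover have "u * 1 \<le> u * l" "v * 1 \<le> v * (l + m2)"
      using l by (simp_all only: mult_le_mono order.refl trans_le_add1)
    ultimately have "u + v \<le> n"
      by linarith
    then have le: "u + v \<le> M"
      using assms(2) False by (simp add: n_def)
    have "c u v * (-1) ^ v * p ^ (v * m2) * (A * (t - 1)) ^ (u + v) =
        c u v * p ^ (v * m2) * A ^ (u + v) * ((-1) ^ v * (t - 1) ^ (u + v))"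
      by (simp add: power_mult_distrib)
    also have "\<dots> = (\<Sum>m\<le>M. c u v * real ((u + v) choose m) * (-1) powi (int u - int m)
        * p ^ (v * m2) * A ^ (u + v) * t ^ m)"
      unfolding binomial_expansion_shifted[OF le] by (simp add: sum_distrib_left mult_ac)
    finally show "c u v * (-1) ^ v * p ^ (v * m2) * (A * (t - 1)) ^ (u + v) =
      (\<Sum>m\<le>M. c u v * real ((u + v) choose m) * (-1) powi (int u - int m)
        * p ^ (v * m2) * A ^ (u + v) * t ^ m)" .
  qed
  also have "\<dots> = (\<Sum>m\<le>M. \<Sum>u = 0..n div l. \<Sum>v = 0..(n - u * l) div (l + m2).
      c u v * real ((u + v) choose m) * (-1) powi (int u - int m) * p ^ (v * m2) * A ^ (u + v) * t ^ m)"
    by (simp only: sum.swap[where B = "{..M}"])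
  also have "\<dots> = (\<Sum>m\<le>M. VV l1 l2 k2 p (int m) N * t ^ m)"
    using False unfolding VV_def Let_def m2_def[symmetric] l_def[symmetric] n_def[symmetric]
      A_def[symmetric] c_def[symmetric] by (simp add: sum_distrib_right)
  finally show ?thesis .
qed

section \<open>The recurrence for the generating function\<close>

text \<open>Extended by 0 to negative lengths, so that one recurrence holds at every
  integer.\<close>

definition list_pgf :: "nat \<Rightarrow> nat \<Rightarrow> nat \<Rightarrow> real \<Rightarrow> real \<Rightarrow> int \<Rightarrow> real" where
  "list_pgf l1 l2 k2 p t N =
     (if N < 0 then 0 else bern_sum p (nat N) (\<lambda>xs. t ^ list_count l1 l2 k2 xs))"

text \<open>A leading 1 does not change the count, so words starting with 1 contribute
  \<open>p\<close> times the value at length \<open>n\<close>; the rest comes from a leading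
  0.\<close>

lemma bern_sum_starting_zero:
  assumes "1 \<le> l1"
  shows "(1 - p) * bern_sum p n (\<lambda>xs. t ^ list_count l1 l2 k2 (0 # xs)) =
    list_pgf l1 l2 k2 p t (int n + 1) - p * list_pgf l1 l2 k2 p t (int n)"
  using list_count_Cons_1[OF assms, of l2 k2]
  by (simp add: list_pgf_def nat_add_distrib del: list_count.simps One_nat_def)

text \<open>After the block, the word is again one that starts with 0, namely the terminating zero.
  At \<open>n + 1 = l1 + i\<close> there is no room for that zero and the true value is 0, so the
  value 1 of \<open>list_pgf\<close> at length 0 is subtracted.\<close>

lemma bern_sum_one_pattern:
  assumes "1 \<le> l1" "1 \<le> i"
  shows "bern_sum p (Suc n)
      (\<lambda>xs. of_bool (prefix (replicate l1 0 @ replicate i 1 @ [0]) xs) * t ^ list_count l1 l2 k2 (tl xs)) =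
    (1 - p) ^ l1 * p ^ i * (list_pgf l1 l2 k2 p t (int n + 1 - int (l1 + i))
      - p * list_pgf l1 l2 k2 p t (int n - int (l1 + i)) - of_bool (n + 1 = l1 + i))"
proof (cases "l1 + i \<le> n")
  case True
  define u :: "nat list" where "u = replicate l1 0 @ replicate i 1 @ [0]"
  have u: "set u \<subseteq> {0, 1}" "length u = Suc (l1 + i)"
    by (auto simp: u_def)
  have weight: "word_weight p u = (1 - p) ^ l1 * p ^ i * (1 - p)"
    by (simp add: word_weight_def u_def prod_list_replicate)
  have tl_u: "list_count l1 l2 k2 (tl (u @ xs)) = list_count l1 l2 k2 (0 # xs)" for xs
    using list_count_pattern_tail[OF assms, of l2 k2 "0 # xs"] by (simp add: u_def del: list_count.simps)
  have "bern_sum p (Suc n) (\<lambda>xs. of_bool (prefix u xs) * t ^ list_count l1 l2 k2 (tl xs)) =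
      word_weight p u * bern_sum p (Suc n - length u) (\<lambda>xs. t ^ list_count l1 l2 k2 (tl (u @ xs)))"
    by (rule bern_sum_prefix) (use u True in auto)
  also have "\<dots> = (1 - p) ^ l1 * p ^ i *
      ((1 - p) * bern_sum p (n - (l1 + i)) (\<lambda>xs. t ^ list_count l1 l2 k2 (0 # xs)))"
    unfolding tl_u weight u(2) by (simp only: diff_Suc_Suc mult.assoc)
  also have "\<dots> = (1 - p) ^ l1 * p ^ i * (list_pgf l1 l2 k2 p t (int n + 1 - int (l1 + i))
      - p * list_pgf l1 l2 k2 p t (int n - int (l1 + i)))"
    unfolding bern_sum_starting_zero[OF assms(1)] using True by (simp add: of_nat_diff algebra_simps)
  finally show ?thesis
    using True by (simp add: u_def)
next
  case False
  have "bern_sum p (Suc n) (\<lambda>xs. of_bool (prefix (replicate l1 0 @ replicate i 1 @ [0]) xs) *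
      t ^ list_count l1 l2 k2 (tl xs)) = bern_sum p (Suc n) (\<lambda>xs. 0)"
    using False by (intro bern_sum_cong) (auto dest: prefix_length_le)
  then show ?thesis
    using False by (auto simp: list_pgf_def)
qed

text \<open>The terminating zero makes the length of the block of ones unique, so at most one
  summand is nonzero.\<close>

lemma has_pattern_prefix_eq_sum:
  "of_bool (has_pattern_prefix l1 l2 k2 xs) =
     (\<Sum>i = l2..k2. of_bool (prefix (replicate l1 0 @ replicate i 1 @ [0]) xs) :: real)"
proof -
  have unique: "i = j" if i: "prefix (replicate l1 0 @ replicate i 1 @ [0]) xs"
    and j: "prefix (replicate l1 0 @ replicate j 1 @ [0]) xs" for i j :: nat
  proof -
    obtain ys where "xs = replicate l1 0 @ replicate i 1 @ 0 # ys"
      using i by (auto simp: prefix_def)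
    moreover obtain zs where "xs = replicate l1 0 @ replicate j 1 @ 0 # zs"
      using j by (auto simp: prefix_def)
    ultimately have "replicate i 1 @ 0 # ys = replicate j 1 @ 0 # zs"
      by simp
    then have "takeWhile (\<lambda>x. x = 1) (replicate i 1 @ 0 # ys) =
        takeWhile (\<lambda>x. x = 1) (replicate j 1 @ 0 # zs)"
      by (rule arg_cong)
    then have "replicate i (1::nat) = replicate j 1"
      by (simp add: takeWhile_append)
    then show ?thesis
      by (simp add: replicate_eq_replicate)
  qed
  show ?thesis
  proof (cases "has_pattern_prefix l1 l2 k2 xs")
    case True
    then obtain i where i: "i \<in> {l2..k2}" "prefix (replicate l1 0 @ replicate i 1 @ [0]) xs"
      by (auto simp: has_pattern_prefix_def)
    then have "prefix (replicate l1 0 @ replicate j 1 @ [0]) xs \<longleftrightarrow> j = i" for j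
      using unique by blast
    then show ?thesis
      using i True by (simp only: of_bool_def if_True sum.delta finite_atLeastAtMost)
  next
    case False
    then show ?thesis
      by (auto simp: has_pattern_prefix_def intro!: sum.neutral[symmetric])
  qed
qed

text \<open>
  The last sum corrects for \<open>list_pgf \<dots> 0 = 1\<close>: a block that reaches the end of the sequence, with no
  room left for its terminating zero, must not contribute.
\<close>

lemma list_pgf_rec:
  fixes p t :: real
  assumes "1 \<le> l1" "1 \<le> l2" "l2 \<le> k2" and l: "l = l1 + l2" and m2: "m2 = k2 - l2 + 1"
  defines "A \<equiv> a_coeff l1 l2 p * (t - 1)"
  shows "list_pgf l1 l2 k2 p t N = list_pgf l1 l2 k2 p t (N - 1)
    + A * list_pgf l1 l2 k2 p t (N - int l)
    - p ^ m2 * A * list_pgf l1 l2 k2 p t (N - int (l + m2))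
    + of_bool (N = 0) - A * (\<Sum>j<m2. p ^ j * of_bool (N - int l - int j = 0))"
proof (cases "N \<le> 0")
  case True
  then show ?thesis
    using assms(1) by (auto simp: list_pgf_def l)
next
  case False
  then obtain n where N: "N = int n + 1"
    by (metis add.commute not_le zero_less_imp_eq_int Suc_pred of_nat_Suc of_nat_0_less_iff)
  define G where "G = list_pgf l1 l2 k2 p t"
  define c where "c = list_count l1 l2 k2"
  \<comment> \<open>Chosen for telescoping: lengthening the block by one multiplies its weight by
    \<open>p\<close>, so the negative term for \<open>j\<close> is the positive term for
    \<open>Suc j\<close>.\<close>
  define F where "F j = p ^ j * G (N - int l - int j)" for j
  have "G N = bern_sum p (Suc n) (\<lambda>xs. t ^ c xs)"
    by (simp add: G_def list_pgf_def N nat_add_distrib c_def)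
  \<comment> \<open>The first position adds an indicator \<open>b\<close> in {0, 1} to the count,
    and \<open>t^b = 1 + (t - 1) * b\<close>.\<close>
  also have "\<dots> = bern_sum p (Suc n) (\<lambda>xs. t ^ c (tl xs) +
      (t - 1) * (\<Sum>i = l2..k2. of_bool (prefix (replicate l1 0 @ replicate i 1 @ [0]) xs) * t ^ c (tl xs)))"
  proof (rule bern_sum_cong)
    fix xs :: "nat list" assume "length xs = Suc n"
    then obtain y ys where "xs = y # ys"
      by (cases xs) auto
    then show "t ^ c xs = t ^ c (tl xs) +
      (t - 1) * (\<Sum>i = l2..k2. of_bool (prefix (replicate l1 0 @ replicate i 1 @ [0]) xs) * t ^ c (tl xs))"
      unfolding sum_distrib_right[symmetric] has_pattern_prefix_eq_sum[symmetric]
      by (simp add: c_def algebra_simps)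
  qed
  also have "\<dots> = bern_sum p (Suc n) (\<lambda>xs. t ^ c (tl xs)) + (t - 1) * (\<Sum>i = l2..k2. bern_sum p (Suc n)
      (\<lambda>xs. of_bool (prefix (replicate l1 0 @ replicate i 1 @ [0]) xs) * t ^ c (tl xs)))"
    by (simp only: bern_sum_add bern_sum_cmult bern_sum_sum)
  also have "bern_sum p (Suc n) (\<lambda>xs. t ^ c (tl xs)) = G (N - 1)"
    by (simp add: G_def list_pgf_def N c_def algebra_simps)
  also have "(\<Sum>i = l2..k2. bern_sum p (Suc n)
      (\<lambda>xs. of_bool (prefix (replicate l1 0 @ replicate i 1 @ [0]) xs) * t ^ c (tl xs))) =
      (\<Sum>i = l2..k2. (1 - p) ^ l1 * p ^ i *
        (G (N - int (l1 + i)) - p * G (N - int (l1 + i) - 1) - of_bool (N = int (l1 + i))))"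
  proof (intro sum.cong refl)
    fix i assume "i \<in> {l2..k2}"
    then have i: "1 \<le> i"
      using assms by auto
    have "(n + 1 = l1 + i) = (N = int (l1 + i))" "int n - int (l1 + i) = N - int (l1 + i) - 1"
      unfolding N by linarith+
    then show "bern_sum p (Suc n)
        (\<lambda>xs. of_bool (prefix (replicate l1 0 @ replicate i 1 @ [0]) xs) * t ^ c (tl xs)) =
      (1 - p) ^ l1 * p ^ i *
        (G (N - int (l1 + i)) - p * G (N - int (l1 + i) - 1) - of_bool (N = int (l1 + i)))"
      unfolding c_def G_def bern_sum_one_pattern[OF assms(1) i] by (simp only: N)
  qed
  also have "\<dots> = (\<Sum>j<m2. (1 - p) ^ l1 * p ^ (l2 + j) *
        (G (N - int (l + j)) - p * G (N - int (l + j) - 1) - of_bool (N = int (l + j))))"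
    by (rule sum.reindex_bij_witness[where i = "\<lambda>j. l2 + j" and j = "\<lambda>i. i - l2"])
      (use assms(3) in \<open>auto simp: l m2\<close>)
  also have "\<dots> = a_coeff l1 l2 p * ((\<Sum>j<m2. F j - F (Suc j))
      - (\<Sum>j<m2. p ^ j * of_bool (N - int l - int j = 0)))"
    unfolding sum_distrib_left sum_subtractf[symmetric]
    by (intro sum.cong) (auto simp: F_def a_coeff_def power_add algebra_simps)
  also have "(\<Sum>j<m2. F j - F (Suc j)) = G (N - int l) - p ^ m2 * G (N - int (l + m2))"
    unfolding sum_lessThan_telescope' by (simp add: F_def algebra_simps)
  finally show ?thesis
    using False unfolding G_def[symmetric] A_def by (simp add: algebra_simps)
qed

section \<open>Solving the recurrence\<close>

lemma linear_recurrence_unique: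
  fixes f g :: "int \<Rightarrow> real"
  assumes "1 \<le> l" "1 \<le> k"
    and "\<And>N. N < 0 \<Longrightarrow> f N = g N"
    and "\<And>N. f N = f (N - 1) + A * f (N - int l) + B * f (N - int k) + h N"
    and "\<And>N. g N = g (N - 1) + A * g (N - int l) + B * g (N - int k) + h N"
  shows "f N = g N"
\<comment> \<open>The shift by 1 makes the measure drop also from \<open>N = 0\<close> to negative
  indices.\<close>
proof (induction "nat (N + 1)" arbitrary: N rule: less_induct)
  case less
  show ?case
  proof (cases "N < 0")
    case False
    then have "f (N - 1) = g (N - 1)" "f (N - int l) = g (N - int l)" "f (N - int k) = g (N - int k)"
      using assms(1,2) by (auto intro!: less)
    then show ?thesis
      using assms(4)[of N] assms(5)[of N] by simp
  qed (simp add: assms(3))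
qed

text \<open>\<open>chi\<close> solves the recurrence with a unit impulse at 0. The right side
  combines its translates just as the inhomogeneity \<open>h\<close> combines impulses, so by
  linearity it solves the same recurrence as \<open>list_pgf\<close>.\<close>

lemma list_pgf_eq_chi:
  assumes "1 \<le> l1" "1 \<le> l2" "l2 \<le> k2" and l: "l = l1 + l2" and m2: "m2 = k2 - l2 + 1"
  shows "list_pgf l1 l2 k2 p t N = chi l1 l2 k2 p N t
    - a_coeff l1 l2 p * (t - 1) * (\<Sum>j<m2. p ^ j * chi l1 l2 k2 p (N - int l - int j) t)"
proof -
  define A B where "A = a_coeff l1 l2 p * (t - 1)" and "B = - (p ^ m2 * A)"
  define C where "C N = chi l1 l2 k2 p N t" for N
  define h where "h N = of_bool (N = 0) - A * (\<Sum>j<m2. p ^ j * of_bool (N - int l - int j = 0))"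
    for N :: int
  have C_eq: "C N = trinomial_sum l (l + m2) A B N" for N
    unfolding C_def A_def B_def l by (rule chi_eq_trinomial_sum) (use assms in auto)
  have C_rec: "C N = C (N - 1) + A * C (N - int l) + B * C (N - int (l + m2)) + of_bool (N = 0)" for N
    unfolding C_eq by (rule trinomial_sum_rec) (use assms in auto)
  have "list_pgf l1 l2 k2 p t N = C N - A * (\<Sum>j<m2. p ^ j * C (N - int l - int j))"
  proof (rule linear_recurrence_unique[of l "l + m2" "list_pgf l1 l2 k2 p t"
      "\<lambda>N. C N - A * (\<Sum>j<m2. p ^ j * C (N - int l - int j))" A B h])
    fix N
    show "list_pgf l1 l2 k2 p t N = list_pgf l1 l2 k2 p t (N - 1) + A * list_pgf l1 l2 k2 p t (N - int l)
        + B * list_pgf l1 l2 k2 p t (N - int (l + m2)) + h N"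
      by (subst list_pgf_rec[OF assms]) (simp add: A_def B_def h_def)
    have "(\<Sum>j<m2. p ^ j * C (N - int l - int j)) =
      (\<Sum>j<m2. p ^ j * C (N - 1 - int l - int j)) + A * (\<Sum>j<m2. p ^ j * C (N - int l - int l - int j))
      + B * (\<Sum>j<m2. p ^ j * C (N - int (l + m2) - int l - int j))
      + (\<Sum>j<m2. p ^ j * of_bool (N - int l - int j = 0))"
      unfolding sum_distrib_left sum.distrib[symmetric]
    proof (intro sum.cong refl)
      fix j
      show "p ^ j * C (N - int l - int j) = p ^ j * C (N - 1 - int l - int j)
        + A * (p ^ j * C (N - int l - int l - int j)) + B * (p ^ j * C (N - int (l + m2) - int l - int j))
        + p ^ j * of_bool (N - int l - int j = 0)"
        by (subst C_rec) (simp add: algebra_simps)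
    qed
    then show "C N - A * (\<Sum>j<m2. p ^ j * C (N - int l - int j)) =
        C (N - 1) - A * (\<Sum>j<m2. p ^ j * C (N - 1 - int l - int j))
        + A * (C (N - int l) - A * (\<Sum>j<m2. p ^ j * C (N - int l - int l - int j)))
        + B * (C (N - int (l + m2)) - A * (\<Sum>j<m2. p ^ j * C (N - int (l + m2) - int l - int j))) + h N"
      using C_rec[of N] unfolding h_def by (simp add: algebra_simps)
  next
    fix N :: int assume "N < 0"
    then show "list_pgf l1 l2 k2 p t N = C N - A * (\<Sum>j<m2. p ^ j * C (N - int l - int j))"
      by (simp add: list_pgf_def C_def chi_def)
  qed (use assms in auto)
  then show ?thesis
    by (simp add: A_def C_def)
qed

section \<open>Bernoulli trials\<close>

text \<open>The word of outcomes almost surely lies in the finite set \<open>L\<close>, and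
  independence gives each of its words the probability \<open>word_weight\<close>. Hence the
  integral is a finite sum for any \<open>f\<close>.\<close>

lemma (in prob_space) integral_bernoulli_trials:
  fixes \<zeta> :: "nat \<Rightarrow> 'a \<Rightarrow> nat" and f :: "nat list \<Rightarrow> real"
  assumes indep: "indep_vars (\<lambda>_. count_space UNIV) \<zeta> {1..}"
    and one: "\<And>i. 1 \<le> i \<Longrightarrow> prob {\<omega> \<in> space M. \<zeta> i \<omega> = 1} = p"
    and zero: "\<And>i. 1 \<le> i \<Longrightarrow> prob {\<omega> \<in> space M. \<zeta> i \<omega> = 0} = 1 - p"
    and "1 \<le> n"
  shows "(\<integral>\<omega>. f (map (\<lambda>i. \<zeta> i \<omega>) [1..<Suc n]) \<partial>M) = bern_sum p n f"
proof -
  define X where "X \<omega> = map (\<lambda>i. \<zeta> i \<omega>) [1..<Suc n]" for \<omega>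
  define L where "L = {xs::nat list. length xs = n \<and> set xs \<subseteq> {0, 1}}"
  have fin: "finite L"
    using finite_lists_length_eq[of "{0, 1::nat}" n] by (simp add: L_def conj_commute)
  have \<zeta>[measurable]: "\<zeta> i \<in> measurable M (count_space UNIV)" if "1 \<le> i" for i
    using indep that by (auto simp: indep_vars_def)
  \<comment> \<open>Trial \<open>i\<close> is the letter with index \<open>i - 1\<close>. As
    \<open>n >= 1\<close> the intersection is over a nonempty family; an empty one would be
    \<open>UNIV\<close> rather than \<open>space M\<close>.\<close>
  have X_eq: "X -` {xs} \<inter> space M = (\<Inter>i\<in>{1..n}. \<zeta> i -` {xs ! (i - 1)} \<inter> space M)"
    if "length xs = n" for xs
  proof -
    have "X \<omega> = xs \<longleftrightarrow> (\<forall>i\<in>{1..n}. \<zeta> i \<omega> = xs ! (i - 1))" for \<omega>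
    proof
      assume "\<forall>i\<in>{1..n}. \<zeta> i \<omega> = xs ! (i - 1)"
      then show "X \<omega> = xs"
        using that by (intro nth_equalityI) (auto simp: X_def simp del: upt_Suc)
    qed (auto simp: X_def simp del: upt_Suc)
    then show ?thesis
      using \<open>1 \<le> n\<close> by auto
  qed
  \<comment> \<open>Lists of naturals form a countable type, so preimages of single words
    suffice.\<close>
  have X[measurable]: "X \<in> measurable M (count_space UNIV)"
  proof (subst measurable_count_space_eq_countable)
    show "X \<in> space M \<rightarrow> UNIV \<and> (\<forall>xs\<in>UNIV. X -` {xs} \<inter> space M \<in> events)"
    proof (intro conjI ballI)
      fix xs
      show "X -` {xs} \<inter> space M \<in> events"
      proof (cases "length xs = n")
        case True
        show ?thesis
          unfolding X_eq[OF True] using \<open>1 \<le> n\<close> \<zeta>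
          by (intro sets.finite_INT) (auto intro!: measurable_sets)
      next
        case False
        then have "X -` {xs} \<inter> space M = {}"
          by (auto simp: X_def simp del: upt_Suc)
        then show ?thesis by simp
      qed
    qed auto
  qed auto
  have prob_X: "prob (X -` {xs} \<inter> space M) = word_weight p xs" if "xs \<in> L" for xs
  proof -
    have len: "length xs = n" and bits: "\<And>i. i < n \<Longrightarrow> xs ! i = 0 \<or> xs ! i = 1"
      using that nth_mem unfolding L_def by fastforce+
    have "prob (X -` {xs} \<inter> space M) = (\<Prod>i\<in>{1..n}. prob (\<zeta> i -` {xs ! (i - 1)} \<inter> space M))"
      unfolding X_eq[OF len]
    proof (rule indep_setsD)
      show "indep_sets (\<lambda>i. {\<zeta> i -` A \<inter> space M | A. A \<in> sets (count_space UNIV)}) {1..}"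
        using indep by (auto simp: indep_vars_def2)
    qed (use \<open>1 \<le> n\<close> in auto)
    also have "\<dots> = (\<Prod>i\<in>{1..n}. if xs ! (i - 1) = 0 then 1 - p else p)"
    proof (intro prod.cong refl)
      fix i assume i: "i \<in> {1..n}"
      have "\<zeta> i -` {c} \<inter> space M = {\<omega> \<in> space M. \<zeta> i \<omega> = c}" for c
        by auto
      then show "prob (\<zeta> i -` {xs ! (i - 1)} \<inter> space M) = (if xs ! (i - 1) = 0 then 1 - p else p)"
        using bits[of "i - 1"] one[of i] zero[of i] i by auto
    qed
    also have "\<dots> = (\<Prod>i<n. if xs ! i = 0 then 1 - p else p)"
      by (rule prod.reindex_bij_witness[where i = Suc and j = "\<lambda>i. i - 1"]) auto
    also have "\<dots> = word_weight p xs"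
      by (simp add: word_weight_def prod.list_conv_set_nth len atLeast0LessThan)
    finally show ?thesis .
  qed
  \<comment> \<open>The trials take arbitrary natural values a priori; the probabilities of 0 and 1
    already add up to 1.\<close>
  have "AE \<omega> in M. \<zeta> i \<omega> \<in> {0, 1}" if "1 \<le> i" for i
  proof (rule AE_I_eq_1)
    have "prob {\<omega> \<in> space M. \<zeta> i \<omega> \<in> {0, 1}} =
        prob ({\<omega> \<in> space M. \<zeta> i \<omega> = 0} \<union> {\<omega> \<in> space M. \<zeta> i \<omega> = 1})"
      by (intro arg_cong[where f = prob]) auto
    also have "\<dots> = 1"
      using \<zeta>[OF that] one[OF that] zero[OF that] by (subst finite_measure_Union) auto
    finally show "emeasure M {\<omega> \<in> space M. \<zeta> i \<omega> \<in> {0, 1}} = 1"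
      by (simp add: emeasure_eq_measure)
    show "{\<omega> \<in> space M. \<zeta> i \<omega> \<in> {0, 1}} \<in> events"
      using measurable_sets[OF \<zeta>[OF that], of "{0, 1}"] by (simp add: vimage_def Int_def conj_commute)
  qed
  then have "AE \<omega> in M. \<forall>i\<in>{1..n}. \<zeta> i \<omega> \<in> {0, 1}"
    by (subst AE_finite_all) auto
  then have "AE \<omega> in M. X \<omega> \<in> L"
  proof eventually_elim
    fix \<omega> assume "\<forall>i\<in>{1..n}. \<zeta> i \<omega> \<in> {0, 1}"
    then have "(\<lambda>i. \<zeta> i \<omega>) ` {1..n} \<subseteq> {0, 1}"
      by (simp only: image_subset_iff)
    then show "X \<omega> \<in> L"
      by (simp add: X_def L_def atLeastLessThanSuc_atLeastAtMost del: upt_Suc)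
  qed
  then have "AE \<omega> in M. f (X \<omega>) = (\<Sum>xs\<in>L. f xs * indicator (X -` {xs} \<inter> space M) \<omega>)"
    using AE_space
  proof eventually_elim
    fix \<omega> assume "X \<omega> \<in> L" "\<omega> \<in> space M"
    then have "(\<Sum>xs\<in>L. f xs * indicator (X -` {xs} \<inter> space M) \<omega>) =
        (\<Sum>xs\<in>L. if xs = X \<omega> then f xs else 0)"
      by (intro sum.cong refl) (simp add: indicator_def eq_commute)
    also have "\<dots> = f (X \<omega>)"
      using sum.delta[OF fin, of "X \<omega>" f] \<open>X \<omega> \<in> L\<close> by simp
    finally show "f (X \<omega>) = (\<Sum>xs\<in>L. f xs * indicator (X -` {xs} \<inter> space M) \<omega>)" ..
  qed
  then have "(\<integral>\<omega>. f (X \<omega>) \<partial>M) = (\<integral>\<omega>. (\<Sum>xs\<in>L. f xs * indicator (X -` {xs} \<inter> space M) \<omega>) \<partial>M)"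
    by (intro integral_cong_AE) auto
  also have "\<dots> = (\<Sum>xs\<in>L. f xs * prob (X -` {xs} \<inter> space M))"
  proof (subst Bochner_Integration.integral_sum)
    fix xs
    have "X -` {xs} \<inter> space M \<in> events"
      using X by (rule measurable_sets) simp
    then have "integrable M (indicator (X -` {xs} \<inter> space M) :: 'a \<Rightarrow> real)"
      by (rule integrable_real_indicator) (simp add: emeasure_eq_measure)
    then show "integrable M (\<lambda>\<omega>. f xs * indicator (X -` {xs} \<inter> space M) \<omega>)"
      by (rule integrable_mult_right)
  qed (simp add: Int_absorb2)
  also have "\<dots> = bern_sum p n f"
    unfolding bern_sum_eq_sum_lists by (intro sum.cong) (auto simp: prob_X L_def)
  finally show ?thesis
    by (simp add: X_def)
qed

section \<open>Comparing coefficients of powers of \<open>t\<close>\<close>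

lemma t_minus_one_chi_eq_sum_VV:
  assumes "1 \<le> l1 + l2" "N \<le> int K"
  shows "(t - 1) * chi l1 l2 k2 p N t =
    (\<Sum>m\<le>Suc K. (VV l1 l2 k2 p (int m - 1) N - VV l1 l2 k2 p (int m) N) * t ^ m)"
proof -
  have "t * chi l1 l2 k2 p N t = (\<Sum>m\<le>K. VV l1 l2 k2 p (int m) N * t ^ Suc m)"
    unfolding chi_eq_sum_VV[OF assms] by (simp add: sum_distrib_left mult_ac)
  \<comment> \<open>Multiplication by \<open>t\<close> shifts the coefficients up; the new constant
    term is 0 because \<open>VV\<close> vanishes at index -1.\<close>
  also have "\<dots> = (\<Sum>m\<le>Suc K. VV l1 l2 k2 p (int m - 1) N * t ^ m)"
    unfolding sum.atMost_Suc_shift by (simp add: VV_def)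
  finally have "t * chi l1 l2 k2 p N t = (\<Sum>m\<le>Suc K. VV l1 l2 k2 p (int m - 1) N * t ^ m)" .
  moreover have "chi l1 l2 k2 p N t = (\<Sum>m\<le>Suc K. VV l1 l2 k2 p (int m) N * t ^ m)"
    by (rule chi_eq_sum_VV) (use assms in auto)
  ultimately show ?thesis
    by (simp only: left_diff_distrib sum_subtractf mult_1)
qed

text \<open>A word of length \<open>n\<close> has at most \<open>n\<close> occurrences, so the
  generating function is a polynomial whose coefficients are the point probabilities.\<close>

lemma list_pgf_eq_sum_pmf:
  assumes "n \<le> K"
  shows "list_pgf l1 l2 k2 p t (int n) =
    (\<Sum>m\<le>K. bern_sum p n (\<lambda>xs. of_bool (list_count l1 l2 k2 xs = m)) * t ^ m)"
proof -
  have "bern_sum p n (\<lambda>xs. t ^ list_count l1 l2 k2 xs) =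
      bern_sum p n (\<lambda>xs. \<Sum>m\<le>K. t ^ m * of_bool (list_count l1 l2 k2 xs = m))"
  proof (rule bern_sum_cong)
    fix xs :: "nat list" assume "length xs = n"
    then have "list_count l1 l2 k2 xs \<le> K"
      using list_count_le_length[of l1 l2 k2 xs] assms by simp
    then show "t ^ list_count l1 l2 k2 xs = (\<Sum>m\<le>K. t ^ m * of_bool (list_count l1 l2 k2 xs = m))"
      by (simp add: of_bool_def if_distrib[of "(*) _"] cong: if_cong)
  qed
  then show ?thesis
    unfolding bern_sum_sum bern_sum_cmult by (simp add: list_pgf_def mult.commute)
qed

theorem theorem2p5:
  fixes M :: "'a measure" and \<zeta> :: "nat \<Rightarrow> 'a \<Rightarrow> nat"
    and p q :: real and l1 l2 k2 l m2 n :: nat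
  assumes "prob_space M"
    and "prob_space.indep_vars M (\<lambda>_. count_space UNIV) \<zeta> {1..}"
    and "p \<in> {0..1}" and "q = 1 - p"
    and "\<And>i. 1 \<le> i \<Longrightarrow> measure M {\<omega> \<in> space M. \<zeta> i \<omega> = 1} = p"
    and "\<And>i. 1 \<le> i \<Longrightarrow> measure M {\<omega> \<in> space M. \<zeta> i \<omega> = 0} = q"
    and "1 \<le> l1" and "1 \<le> l2" and "l2 \<le> k2"
    and "l = l1 + l2" and "m2 = k2 - l2 + 1"
    and "l + 1 \<le> n"
  shows
    "(\<forall>t::real.
        (\<integral>\<omega>. t ^ pattern_count l1 l2 k2 n (\<lambda>i. \<zeta> i \<omega>) \<partial>M) =
        chi l1 l2 k2 p (int n) t
        - a_coeff l1 l2 p * (t - 1) *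
          (\<Sum>i = l..l + m2 - 1. p ^ (i - l) * chi l1 l2 k2 p (int n - int i) t)) \<and>
     (\<forall>m::nat.
        measure M {\<omega> \<in> space M. pattern_count l1 l2 k2 n (\<lambda>i. \<zeta> i \<omega>) = m} =
        VV l1 l2 k2 p (int m) (int n)
        - a_coeff l1 l2 p *
          (\<Sum>i = l..l + m2 - 1. p ^ (i - l) *
             (VV l1 l2 k2 p (int m - 1) (int n - int i) - VV l1 l2 k2 p (int m) (int n - int i))))"
proof -
  interpret prob_space M by fact
  define P where "P m = bern_sum p n (\<lambda>xs. of_bool (list_count l1 l2 k2 xs = m))" for m
  define D where
    "D m N = VV l1 l2 k2 p (int m - 1) N - VV l1 l2 k2 p (int m) N" for m N
  \<comment> \<open>Stated for general \<open>f\<close> because powers of \<open>t\<close> give (i)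
    and indicators of single values give (ii).\<close>
  have integral: "(\<integral>\<omega>. f (pattern_count l1 l2 k2 n (\<lambda>i. \<zeta> i \<omega>)) \<partial>M) =
      bern_sum p n (\<lambda>xs. f (list_count l1 l2 k2 xs))" for f :: "nat \<Rightarrow> real"
    unfolding pattern_count_eq_list_count[OF \<open>l2 \<le> k2\<close>]
    by (rule integral_bernoulli_trials[where f = "\<lambda>xs. f (list_count l1 l2 k2 xs)"])
      (use assms in auto)
  have pmf: "prob {\<omega> \<in> space M. pattern_count l1 l2 k2 n (\<lambda>i. \<zeta> i \<omega>) = m} = P m" for m
  proof -
    have "prob {\<omega> \<in> space M. pattern_count l1 l2 k2 n (\<lambda>i. \<zeta> i \<omega>) = m} =
        (\<integral>\<omega>. indicator {\<omega> \<in> space M. pattern_count l1 l2 k2 n (\<lambda>i. \<zeta> i \<omega>) = m} \<omega> \<partial>M)"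
      by (simp add: Int_absorb2)
    also have "\<dots> = (\<integral>\<omega>. of_bool (pattern_count l1 l2 k2 n (\<lambda>i. \<zeta> i \<omega>) = m) \<partial>M)"
      by (intro Bochner_Integration.integral_cong) (auto simp: indicator_def)
    also have "\<dots> = P m"
      unfolding P_def by (rule integral)
    finally show ?thesis .
  qed
  have shift: "(\<Sum>j<m2. p ^ j * F (int n - int l - int j)) =
      (\<Sum>i = l..l + m2 - 1. p ^ (i - l) * F (int n - int i))" for F :: "int \<Rightarrow> real"
    by (rule sum.reindex_bij_witness[where i = "\<lambda>i. i - l" and j = "\<lambda>j. l + j"])
      (use \<open>m2 = k2 - l2 + 1\<close> in \<open>auto simp: algebra_simps\<close>)
  have pgf: "list_pgf l1 l2 k2 p t (int n) = chi l1 l2 k2 p (int n) t - a_coeff l1 l2 p * (t - 1) *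
      (\<Sum>i = l..l + m2 - 1. p ^ (i - l) * chi l1 l2 k2 p (int n - int i) t)" for t
    unfolding shift[of "\<lambda>N. chi l1 l2 k2 p N t", symmetric] by (rule list_pgf_eq_chi) fact+
  have "P m = VV l1 l2 k2 p (int m) (int n)
      - a_coeff l1 l2 p * (\<Sum>i = l..l + m2 - 1. p ^ (i - l) * D m (int n - int i))" for m
  proof -
    \<comment> \<open>Large enough to cover the degrees in \<open>t\<close> of all polynomials
      involved as well as the index \<open>m\<close> in question.\<close>
    define K where "K = n + m"
    let ?c = "\<lambda>m. VV l1 l2 k2 p (int m) (int n)
      - a_coeff l1 l2 p * (\<Sum>i = l..l + m2 - 1. p ^ (i - l) * D m (int n - int i))"
    have l: "1 \<le> l1 + l2"
      using assms by simp
    have "(\<Sum>m\<le>Suc K. P m * t ^ m) = (\<Sum>m\<le>Suc K. ?c m * t ^ m)" for t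
    proof -
      have D: "(t - 1) * chi l1 l2 k2 p (int n - int i) t = (\<Sum>m\<le>Suc K. D m (int n - int i) * t ^ m)" for i
        unfolding D_def by (rule t_minus_one_chi_eq_sum_VV) (use l in \<open>auto simp: K_def\<close>)
      have "(\<Sum>m\<le>Suc K. P m * t ^ m) = list_pgf l1 l2 k2 p t (int n)"
        unfolding P_def by (rule list_pgf_eq_sum_pmf[symmetric]) (simp add: K_def)
      also have "\<dots> = chi l1 l2 k2 p (int n) t - a_coeff l1 l2 p *
          (\<Sum>i = l..l + m2 - 1. p ^ (i - l) * ((t - 1) * chi l1 l2 k2 p (int n - int i) t))"
        unfolding pgf by (simp add: sum_distrib_left mult_ac)
      also have "chi l1 l2 k2 p (int n) t = (\<Sum>m\<le>Suc K. VV l1 l2 k2 p (int m) (int n) * t ^ m)"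
        by (rule chi_eq_sum_VV) (use l in \<open>auto simp: K_def\<close>)
      also have "(\<Sum>i = l..l + m2 - 1. p ^ (i - l) * ((t - 1) * chi l1 l2 k2 p (int n - int i) t)) =
          (\<Sum>m\<le>Suc K. (\<Sum>i = l..l + m2 - 1. p ^ (i - l) * D m (int n - int i)) * t ^ m)"
        unfolding D sum_distrib_left sum_distrib_right mult.assoc by (rule sum.swap)
      finally show ?thesis
        by (simp only: left_diff_distrib sum_subtractf
            sum_distrib_left[where A = "{..Suc K}"] mult.assoc)
    qed
    \<comment> \<open>Two real polynomials that agree at every \<open>t\<close> have equal
      coefficients.\<close>
    then have "\<forall>m\<le>Suc K. P m = ?c m"
      unfolding polyfun_eq_coeffs[symmetric] by blast
    then show ?thesis
      by (simp add: K_def)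
  qed
  then show ?thesis
    using pgf by (simp add: pmf D_def integral[of "\<lambda>k. _ ^ k"] list_pgf_def)
qed

end
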